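(* Let $n$ be a positive integer, let $\varepsilon$ be a positive real number, and let $G$ be a connected non-complete graph with $t(G)\geq 1+\varepsilon$ and $|V(G)|\equiv n\pmod 2$. If $\kappa(G)>\frac{(n-2)(1+\varepsilon)}{\varepsilon}$, then $G$ is $n$-factor-critical.
   Context: All graphs are finite, simple and connected. $\kappa(G)$ denotes the vertex connectivity of $G$, and $c(H)$ denotes the number of connected components of a graph $H$. For a non-complete graph $G$, the toughness is $t(G)=\min \frac{|S|}{c(G-S)}$, the minimum taken over all vertex cut-sets $S\subset V(G)$ (sets $S$ for which $G-S$ is disconnected). A perfect matching is a set of pairwise vertex-disjoint edges covering all vertices. A graph $G$ with $|V(G)|\geq n+2$ and $|V(G)|\equiv n \pmod 2$ is called $n$-factor-critical if, after deleting any $n$ vertices from $G$, the remaining subgraph has a perfect matching. *)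

theory Defs
  imports Complex_Main "Graph_Theory.Graph_Theory"
begin

text \<open>
  Finite simple graphs are the loop-free symmetric digraphs without parallel arcs of
  the locale \<open>graph\<close>; an undirected edge corresponds to two opposite arcs.
\<close>

abbreviation delete_verts :: "('a, 'b) pre_digraph \<Rightarrow> 'a set \<Rightarrow> ('a, 'b) pre_digraph" where
  "delete_verts G S \<equiv> G \<restriction> (verts G - S)"

text \<open>In a symmetric digraph the strongly connected components are the connected components.\<close>

definition num_components :: "('a, 'b) pre_digraph \<Rightarrow> nat" where
  "num_components G = card (pre_digraph.sccs G)"

text \<open>
  The inclusion is proper because in this library the null graph is not connected, so
  \<open>S = verts G\<close> would otherwise count as a cut-set.
\<close>

definition vertex_cut_set :: "('a, 'b) pre_digraph \<Rightarrow> 'a set \<Rightarrow> bool" where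
  "vertex_cut_set G S \<longleftrightarrow>
     S \<subset> verts G \<and> \<not> Digraph_Component.connected (delete_verts G S)"

text \<open>Meaningful only for finite non-complete graphs; a complete graph has no cut-set.\<close>

definition toughness :: "('a, 'b) pre_digraph \<Rightarrow> real" where
  "toughness G =
     Min {real (card S) / real (num_components (delete_verts G S)) | S. vertex_cut_set G S}"

text \<open>
  The second disjunct gives a complete graph on \<open>m\<close> vertices the usual connectivity \<open>m - 1\<close>;
  it does not affect the value for non-complete graphs.
\<close>

definition vertex_connectivity :: "('a, 'b) pre_digraph \<Rightarrow> nat" where
  "vertex_connectivity G =
     Min {card S | S. vertex_cut_set G S \<or> S \<subseteq> verts G \<and> card (verts G - S) = 1}"

definition undirected_edges :: "('a, 'b) pre_digraph \<Rightarrow> 'a set set" where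
  "undirected_edges G = {{u, v} | u v. (u, v) \<in> arcs_ends G}"

definition perfect_matching :: "('a, 'b) pre_digraph \<Rightarrow> 'a set set \<Rightarrow> bool" where
  "perfect_matching G M \<longleftrightarrow>
     M \<subseteq> undirected_edges G \<and> pairwise disjnt M \<and> \<Union>M = verts G"

definition factor_critical :: "nat \<Rightarrow> ('a, 'b) pre_digraph \<Rightarrow> bool" where
  "factor_critical n G \<longleftrightarrow>
     card (verts G) \<ge> n + 2 \<and> card (verts G) mod 2 = n mod 2 \<and>
     (\<forall>S \<subseteq> verts G. card S = n \<longrightarrow> (\<exists>M. perfect_matching (delete_verts G S) M))"

end

theory Submission
  imports Defs
begin

text \<open>
  By the Tutte--Berge theorem, a graph \<open>G - S\<close> of even order without a perfect matching
  contains a set \<open>T\<close> such that \<open>G - (S \<union> T)\<close> has at least \<open>|T| + 2\<close> components.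
  So \<open>S \<union> T\<close> is a cut-set, and toughness bounds \<open>|T| + 2\<close> by \<open>(n - 2) / \<epsilon>\<close>; the cut-set
  then has size \<open>n + |T| \<le> (n - 2) (1 + \<epsilon>) / \<epsilon>\<close>, which is below the connectivity.

  The Tutte--Berge theorem is proved by induction on the order. If some vertex lies in every
  maximum matching, delete it. Otherwise Gallai's lemma applies: a maximum matching misses at
  most one vertex in each component, so the components with a missed vertex are odd and the
  empty set is the required barrier.
\<close>

section \<open>Matchings\<close>

definition matching :: "('a, 'b) pre_digraph \<Rightarrow> 'a set set \<Rightarrow> bool" where
  "matching G M \<longleftrightarrow> M \<subseteq> undirected_edges G \<and> pairwise disjnt M"

definition maximum_matching :: "('a, 'b) pre_digraph \<Rightarrow> 'a set set \<Rightarrow> bool" where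
  "maximum_matching G M \<longleftrightarrow> matching G M \<and> (\<forall>M'. matching G M' \<longrightarrow> card M' \<le> card M)"

lemma perfect_matching_conv: "perfect_matching G M \<longleftrightarrow> matching G M \<and> \<Union>M = verts G"
  by (auto simp: perfect_matching_def matching_def)

lemma matching_meet_eq:
  assumes "matching G M" "e \<in> M" "f \<in> M" "x \<in> e" "x \<in> f"
  shows "e = f"
  using assms by (auto simp: matching_def pairwise_def disjnt_def)

lemma matching_insert:
  assumes "matching G M" "e \<in> undirected_edges G" "e \<inter> \<Union>M = {}"
  shows "matching G (insert e M)"
  using assms by (auto simp: matching_def pairwise_insert disjnt_def)

context graph
begin

lemma undirected_edge_subset: "e \<in> undirected_edges G \<Longrightarrow> e \<subseteq> verts G"
  by (auto simp: undirected_edges_def dest: adj_in_verts)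

text \<open>Symmetry of the arcs lets either end of an edge be listed first; the absence of loops
  makes the two ends distinct.\<close>

lemma undirected_edge_endpoint:
  assumes "e \<in> undirected_edges G" "x \<in> e"
  obtains y where "e = {x, y}" "y \<noteq> x" "x \<rightarrow> y"
proof -
  obtain u v where uv: "e = {u, v}" "u \<rightarrow> v"
    using assms by (auto simp: undirected_edges_def)
  then have "v \<rightarrow> u" "u \<noteq> v"
    using arcs_ends_symmetric[OF sym_arcs] adj_not_same by auto
  then show thesis
    using that uv assms(2) by (metis doubleton_eq_iff insertE singletonD)
qed

lemma card_undirected_edge: "e \<in> undirected_edges G \<Longrightarrow> card e = 2"
proof -
  assume e: "e \<in> undirected_edges G"
  then obtain x where "x \<in> e" by (auto simp: undirected_edges_def)
  with e obtain y where "e = {x, y}" "y \<noteq> x" by (rule undirected_edge_endpoint)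
  then show "card e = 2" by simp
qed

lemma finite_undirected_edges: "finite (undirected_edges G)"
proof (rule finite_subset)
  show "undirected_edges G \<subseteq> Pow (verts G)" using undirected_edge_subset by blast
qed simp

lemma finite_matching: "matching G M \<Longrightarrow> finite M"
  using finite_undirected_edges by (auto simp: matching_def intro: finite_subset)

lemma Union_matching_subset: "matching G M \<Longrightarrow> \<Union>M \<subseteq> verts G"
  using undirected_edge_subset by (auto simp: matching_def)

lemma finite_Union_matching: "matching G M \<Longrightarrow> finite (\<Union>M)"
  using Union_matching_subset finite_verts finite_subset by blast

lemma card_Union_matching:
  assumes "matching G M"
  shows "card (\<Union>M) = 2 * card M"
proof -
  have 2: "card e = 2" if "e \<in> M" for e
    using assms that card_undirected_edge by (auto simp: matching_def)
  have "card (\<Union>M) = sum card M"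
    using assms 2 by (intro card_Union_disjoint) (auto simp: matching_def intro!: card_ge_0_finite)
  then show ?thesis using 2 by simp
qed

lemma ex_maximum_matching: "\<exists>M. maximum_matching G M"
proof -
  have "\<exists>M. matching G M \<and> (\<forall>M'. matching G M' \<longrightarrow> card M' \<le> card M)"
  proof (rule ex_has_greatest_nat)
    show "matching G {}" by (simp add: matching_def)
    show "\<forall>M. matching G M \<longrightarrow> card M < Suc (card (undirected_edges G))"
      using finite_undirected_edges by (auto simp: matching_def less_Suc_eq_le intro: card_mono)
  qed
  then show ?thesis by (simp add: maximum_matching_def)
qed

text \<open>An edge avoiding \<open>\<Union>M\<close> could be added to \<open>M\<close>,
  contradicting maximality.\<close>

lemma maximum_matching_meets_edge:
  assumes "maximum_matching G M" "e \<in> undirected_edges G"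
  shows "e \<inter> \<Union>M \<noteq> {}"
proof
  assume disj: "e \<inter> \<Union>M = {}"
  have M: "matching G M" using assms by (simp add: maximum_matching_def)
  then have "matching G (insert e M)" using assms disj by (intro matching_insert)
  moreover have "e \<notin> M"
    using disj card_undirected_edge[OF assms(2)] by (metis Int_absorb2 Union_upper card.empty zero_neq_numeral)
  then have "card (insert e M) = Suc (card M)" using finite_matching[OF M] by simp
  ultimately show False using assms(1) by (auto simp: maximum_matching_def)
qed

lemma card_maximum_matching_eq:
  "maximum_matching G M \<Longrightarrow> maximum_matching G N \<Longrightarrow> card M = card N"
  by (auto simp: maximum_matching_def intro: antisym)

section \<open>Gallai's lemma and the Tutte--Berge theorem\<close>

text \<open>The relation behind Gallai's lemma: it holds along edges and passes through a middle
  vertex that some maximum matching misses. It fails for \<open>u = v\<close> as soon as a maximum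
  matching misses \<open>u\<close>, so equality is treated separately.\<close>

definition jointly_covered :: "'a \<Rightarrow> 'a \<Rightarrow> bool" where
  "jointly_covered u v \<longleftrightarrow> (\<forall>M. maximum_matching G M \<longrightarrow> u \<in> \<Union>M \<or> v \<in> \<Union>M)"

text \<open>
  Take \<open>M\<close> missing \<open>u\<close> and \<open>v\<close>, and \<open>N\<close> missing \<open>t\<close> that shares as many edges with \<open>M\<close> as
  possible. As \<open>N\<close> covers \<open>u\<close> and \<open>v\<close>, some \<open>x \<noteq> t\<close> is covered by \<open>M\<close> only; exchanging an
  edge of \<open>N\<close> for the edge of \<open>M\<close> at \<open>x\<close> increases the overlap.
\<close>

lemma jointly_covered_trans:
  assumes ut: "jointly_covered u t" and tv: "jointly_covered t v" and "u \<noteq> v"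
    and miss: "\<exists>N. maximum_matching G N \<and> t \<notin> \<Union>N"
  shows "jointly_covered u v"
proof (rule ccontr)
  assume "\<not> jointly_covered u v"
  then obtain M where M: "maximum_matching G M" "u \<notin> \<Union>M" "v \<notin> \<Union>M"
    by (auto simp: jointly_covered_def)
  let ?P = "\<lambda>N. maximum_matching G N \<and> t \<notin> \<Union>N"
  have mM: "matching G M" using M by (simp add: maximum_matching_def)
  have finM: "finite M" using mM by (rule finite_matching)
  obtain N0 where "?P N0" using miss by blast
  moreover have "\<forall>N. ?P N \<longrightarrow> card (M \<inter> N) < Suc (card M)"
    using finM by (auto simp: less_Suc_eq_le intro: card_mono)
  ultimately have "\<exists>N. ?P N \<and> (\<forall>N'. ?P N' \<longrightarrow> card (M \<inter> N') \<le> card (M \<inter> N))"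
    by (rule ex_has_greatest_nat)
  then obtain N where N: "maximum_matching G N" "t \<notin> \<Union>N"
    and best: "\<And>N'. ?P N' \<Longrightarrow> card (M \<inter> N') \<le> card (M \<inter> N)"
    by blast
  have mN: "matching G N" using N by (simp add: maximum_matching_def)
  have finN: "finite N" using mN by (rule finite_matching)
  have fU: "finite (\<Union>M)" "finite (\<Union>N)"
    using mM mN finite_Union_matching by auto
  have "{u, v} \<subseteq> \<Union>N - \<Union>M"
    using ut tv N M by (auto simp: jointly_covered_def)
  then have "card {u, v} \<le> card (\<Union>N - \<Union>M)" using fU by (intro card_mono) auto
  \<comment> \<open>Maximum matchings have equal size, so \<open>M\<close> and \<open>N\<close>
    cover equally many vertices.\<close>
  moreover have "card (\<Union>N - \<Union>M) = card (\<Union>M - \<Union>N)"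
  proof -
    have "card (\<Union>M) = card (\<Union>N)"
      using card_Union_matching mM mN card_maximum_matching_eq M N by metis
    then show ?thesis
      using fU by (metis card_Diff_subset_Int inf_commute finite_Int)
  qed
  ultimately have "2 \<le> card (\<Union>M - \<Union>N)" using \<open>u \<noteq> v\<close> by simp
  \<comment> \<open>Avoiding \<open>t\<close> matters because the exchanged matching covers
    \<open>x\<close> and must still miss \<open>t\<close>.\<close>
  then have "\<not> \<Union>M - \<Union>N \<subseteq> {t}"
    using card_mono[of "{t}" "\<Union>M - \<Union>N"] by auto
  then obtain x e where x: "x \<in> e" "e \<in> M" "x \<notin> \<Union>N" "x \<noteq> t" by blast
  have eE: "e \<in> undirected_edges G" using x mM by (auto simp: matching_def)
  obtain y where y: "e = {x, y}" "y \<noteq> x"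
    using undirected_edge_endpoint[OF eE \<open>x \<in> e\<close>] by blast
  \<comment> \<open>\<open>N\<close> is maximum and misses \<open>x\<close>, so it must cover the
    other end of \<open>e\<close>.\<close>
  have "y \<in> \<Union>N" using maximum_matching_meets_edge[OF N(1) eE] x y by auto
  then obtain f where f: "f \<in> N" "y \<in> f" by blast
  have "f \<noteq> e" using x f by blast
  have "f \<notin> M" using matching_meet_eq[OF mM _ x(2) f(2)] y \<open>f \<noteq> e\<close> by auto
  have "e \<notin> N" using x by blast
  define N' where "N' = insert e (N - {f})"
  have "matching G (N - {f})" using mN by (auto simp: matching_def intro: pairwise_subset)
  moreover have "y \<notin> \<Union>(N - {f})" using matching_meet_eq[OF mN f(1) _ f(2)] by blast
  then have "e \<inter> \<Union>(N - {f}) = {}" using x y by auto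
  ultimately have mN': "matching G N'" unfolding N'_def using eE by (intro matching_insert)
  have "card N' = card N"
    unfolding N'_def using card.remove[OF finN f(1)] finN \<open>e \<notin> N\<close> by simp
  then have "maximum_matching G N'"
    using mN' N(1) by (simp add: maximum_matching_def)
  moreover have "t \<notin> \<Union>N'"
    unfolding N'_def using N(2) x y \<open>y \<in> \<Union>N\<close> by auto
  ultimately have "card (M \<inter> N') \<le> card (M \<inter> N)" by (intro best) simp
  moreover have "M \<inter> N' = insert e (M \<inter> N)"
    unfolding N'_def using x \<open>f \<notin> M\<close> by auto
  ultimately show False using finM \<open>e \<notin> N\<close> by simp
qed

text \<open>Induction along a path: adjacent vertices are jointly covered because every maximum
  matching meets the edge between them, and the hypothesis on missed vertices licenses transitivity
  at each intermediate vertex.\<close>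

lemma reachable_jointly_covered:
  assumes miss: "\<And>t. t \<in> verts G \<Longrightarrow> \<exists>N. maximum_matching G N \<and> t \<notin> \<Union>N"
    and "u \<rightarrow>\<^sup>* v"
  shows "u = v \<or> jointly_covered u v"
  using assms(2)
proof (induction rule: reachable_induct)
  case base
  show ?case by simp
next
  case (step x y)
  have "{x, y} \<in> undirected_edges G" using step by (auto simp: undirected_edges_def)
  then have xy: "jointly_covered x y"
    using maximum_matching_meets_edge unfolding jointly_covered_def by blast
  have "x \<in> verts G" using step adj_in_verts by blast
  then show ?case using step.IH xy jointly_covered_trans miss by blast
qed

text \<open>No edge of \<open>M\<close> leaves the component, so the edges of \<open>M\<close>
  inside it pair up all its vertices except \<open>v\<close>.\<close>

lemma odd_scc_of_missed_vertex:
  assumes M: "matching G M" and v: "v \<in> verts G" "v \<notin> \<Union>M"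
    and only: "\<And>w. w \<in> scc_of v \<Longrightarrow> w \<notin> \<Union>M \<Longrightarrow> w = v"
  shows "odd (card (scc_of v))"
proof -
  define K where "K = {e \<in> M. e \<subseteq> scc_of v}"
  have mK: "matching G K"
    using M by (auto simp: K_def matching_def intro: pairwise_subset)
  have "scc_of v = insert v (\<Union>K)"
  proof
    show "scc_of v \<subseteq> insert v (\<Union>K)"
    proof
      fix w assume w: "w \<in> scc_of v"
      show "w \<in> insert v (\<Union>K)"
      proof (cases "w = v")
        case False
        then obtain e where e: "e \<in> M" "w \<in> e" using only w by blast
        then have "e \<in> undirected_edges G" using M by (auto simp: matching_def)
        then obtain y where y: "e = {w, y}" "w \<rightarrow> y"
          using undirected_edge_endpoint e by metis
        have "v \<rightarrow>\<^sup>* w" using w by (auto simp: scc_of_def)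
        then have "v \<rightarrow>\<^sup>* y" using y reachable_adj_trans by blast
        then have "e \<subseteq> scc_of v" using w y scc_ofI_reachable' by auto
        then show ?thesis using e by (auto simp: K_def)
      qed simp
    qed
    show "insert v (\<Union>K) \<subseteq> scc_of v"
      using v in_scc_of_self by (auto simp: K_def)
  qed
  moreover have "v \<notin> \<Union>K" using v by (auto simp: K_def)
  ultimately show ?thesis
    using card_Union_matching[OF mK] finite_Union_matching[OF mK] by simp
qed

text \<open>Two missed vertices in one component would be jointly covered, which is absurd. Hence
  sending a missed vertex to its component is injective, and the components reached are odd.\<close>

lemma deficiency_le_odd_components:
  assumes miss: "\<And>t. t \<in> verts G \<Longrightarrow> \<exists>N. maximum_matching G N \<and> t \<notin> \<Union>N"
    and M: "maximum_matching G M"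
  shows "card (verts G - \<Union>M) \<le> card {C \<in> sccs_verts. odd (card C)}"
proof -
  have sep: "w = v" if "v \<in> verts G - \<Union>M" "w \<notin> \<Union>M" "w \<in> scc_of v" for v w
  proof -
    have "v \<rightarrow>\<^sup>* w" using that(3) by (simp add: scc_of_def)
    then have "v = w \<or> jointly_covered v w" using miss by (intro reachable_jointly_covered)
    then show ?thesis using that M unfolding jointly_covered_def by blast
  qed
  have "inj_on scc_of (verts G - \<Union>M)"
  proof (rule inj_onI)
    fix v w assume "v \<in> verts G - \<Union>M" "w \<in> verts G - \<Union>M" "scc_of v = scc_of w"
    then have "w \<in> scc_of v" "w \<notin> \<Union>M" using in_scc_of_self[of w] by blast+
    then show "v = w" using sep[OF \<open>v \<in> verts G - \<Union>M\<close>] by blast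
  qed
  moreover have "scc_of ` (verts G - \<Union>M) \<subseteq> {C \<in> sccs_verts. odd (card C)}"
    using sep M odd_scc_of_missed_vertex
    by (auto simp: maximum_matching_def scc_of_in_sccs_verts)
  ultimately show ?thesis
    using finite_sccs_verts by (intro card_inj_on_le) auto
qed

lemma graph_induce_subgraph: "W \<subseteq> verts G \<Longrightarrow> graph (G \<restriction> W)"
  using digraph.graphI digraphI_induced induced_graph_imp_symmetric induced_induce sym_arcs
  by metis

end

lemma (in wf_digraph) delete_verts_empty: "delete_verts G {} = G"
  by (rule pre_digraph.equality) auto

lemma delete_verts_delete_verts:
  "delete_verts (delete_verts G S) T = delete_verts G (S \<union> T)"
  by (rule pre_digraph.equality) auto

lemma undirected_edges_induce_subgraph: "undirected_edges (G \<restriction> W) \<subseteq> undirected_edges G"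
  by (auto simp: undirected_edges_def dest: dominates_induce_subgraphD)

text \<open>This is the inequality of the Tutte--Berge formula that produces a barrier
  \<open>U\<close>. It is written as a sum to avoid truncated subtraction on the naturals.\<close>

theorem Tutte_Berge:
  assumes "Digraph.graph G"
  shows "\<exists>M U. matching G M \<and> U \<subseteq> verts G \<and>
    card U + card (verts G - \<Union>M)
      \<le> card {C \<in> pre_digraph.sccs_verts (delete_verts G U). odd (card C)}"
  using assms
proof (induction "card (verts G)" arbitrary: G rule: less_induct)
  case less
  interpret graph G by fact
  obtain M where M: "maximum_matching G M" using ex_maximum_matching by blast
  then have mM: "matching G M" by (simp add: maximum_matching_def)
  show ?case
  proof (cases "\<forall>t\<in>verts G. \<exists>N. maximum_matching G N \<and> t \<notin> \<Union>N")
    case True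
    then have "card (verts G - \<Union>M) \<le> card {C \<in> sccs_verts. odd (card C)}"
      using M by (intro deficiency_le_odd_components) auto
    then show ?thesis
      using mM delete_verts_empty by (intro exI[of _ M] exI[of _ "{}"]) (simp del: Diff_empty)
  next
    case False
    then obtain v where v: "v \<in> verts G" "\<And>N. maximum_matching G N \<Longrightarrow> v \<in> \<Union>N"
      by blast
    let ?H = "delete_verts G {v}"
    have H: "Digraph.graph ?H" by (intro graph_induce_subgraph) auto
    have vH: "card (verts ?H) < card (verts G)"
      using card_Diff1_less[OF finite_verts v(1)] by simp
    obtain M' U where IH: "matching ?H M'" "U \<subseteq> verts ?H"
      "card U + card (verts ?H - \<Union>M')
        \<le> card {C \<in> pre_digraph.sccs_verts (delete_verts ?H U). odd (card C)}"
      using less.hyps[OF vH H] by blast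
    have mM': "matching G M'"
      using IH(1) undirected_edges_induce_subgraph[of G] by (auto simp: matching_def)
    have sub: "\<Union>M' \<subseteq> verts ?H" using graph.Union_matching_subset[OF H IH(1)] .
    then have "v \<notin> \<Union>M'" by auto
    \<comment> \<open>Every maximum matching of \<open>G\<close> covers \<open>v\<close>, so a
      matching of \<open>?H\<close> has strictly fewer edges than \<open>M\<close>.\<close>
    then have "\<not> maximum_matching G M'" using v(2) by blast
    then have "card M' < card M"
      using M mM' by (force simp: maximum_matching_def)
    have sM: "\<Union>M \<subseteq> verts G" using mM by (rule Union_matching_subset)
    have "card (verts G - \<Union>M) + 2 * card M = card (verts G)"
      using card_Union_matching[OF mM] sM finite_verts card_mono[OF _ sM]
      by (simp add: card_Diff_subset finite_subset)
    moreover have "card (verts ?H - \<Union>M') + 2 * card M' + 1 = card (verts G)"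
    proof -
      have "card (verts ?H - \<Union>M') + card (\<Union>M') = card (verts ?H)"
        using sub finite_verts card_mono[OF _ sub]
        by (simp add: card_Diff_subset finite_subset)
      moreover have "card (verts ?H) + 1 = card (verts G)"
        using card.remove[OF finite_verts v(1)] by simp
      ultimately show ?thesis using card_Union_matching[OF mM'] by simp
    qed
    \<comment> \<open>Deleting \<open>v\<close> loses one vertex, but the matching covers at least
      two vertices fewer. The deficiency thus grows by at least one, which pays for adding
      \<open>v\<close> to the barrier.\<close>
    ultimately have "card (verts G - \<Union>M) + 1 \<le> card (verts ?H - \<Union>M')"
      using \<open>card M' < card M\<close> by linarith
    moreover have "card (insert v U) = card U + 1"
      using IH(2) finite_subset[OF IH(2)] by (subst card_insert_disjoint) auto
    moreover have "delete_verts ?H U = delete_verts G (insert v U)"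
      unfolding delete_verts_delete_verts by simp
    ultimately have "card (insert v U) + card (verts G - \<Union>M)
        \<le> card {C \<in> pre_digraph.sccs_verts (delete_verts G (insert v U)). odd (card C)}"
      using IH(3) by simp
    then show ?thesis
      using mM v IH(2) by (intro exI[of _ M] exI[of _ "insert v U"]) auto
  qed
qed

text \<open>In even order the deficiency is even, so when positive it is at least 2. Odd components
  are then bounded by all components, which is what toughness counts.\<close>

corollary Tutte:
  assumes "Digraph.graph G" "even (card (verts G))" "\<nexists>M. perfect_matching G M"
  shows "\<exists>U\<subseteq>verts G. card U + 2 \<le> num_components (delete_verts G U)"
proof -
  interpret graph G by fact
  obtain M U where M: "matching G M" and U: "U \<subseteq> verts G"
    and le: "card U + card (verts G - \<Union>M)
      \<le> card {C \<in> pre_digraph.sccs_verts (delete_verts G U). odd (card C)}"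
    using Tutte_Berge[OF assms(1)] by blast
  interpret H: graph "delete_verts G U" by (intro graph_induce_subgraph) auto
  have sM: "\<Union>M \<subseteq> verts G" using M by (rule Union_matching_subset)
  then have "verts G - \<Union>M \<noteq> {}"
    using assms(3) M by (auto simp: perfect_matching_conv)
  then have "card (verts G - \<Union>M) \<noteq> 0" by simp
  moreover have "even (card (verts G - \<Union>M))"
    using card_Union_matching[OF M] assms(2) sM finite_Union_matching[OF M]
    by (simp add: card_Diff_subset)
  ultimately have "2 \<le> card (verts G - \<Union>M)"
    by (metis dvd_imp_le not_gr_zero)
  moreover have "card {C \<in> H.sccs_verts. odd (card C)} \<le> num_components (delete_verts G U)"
    unfolding num_components_def H.card_sccs_verts[symmetric]
    using H.finite_sccs_verts by (intro card_mono) auto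
  ultimately show ?thesis using le U by (intro exI[of _ U]) auto
qed

section \<open>Cut-sets, toughness and connectivity\<close>

context graph
begin

text \<open>With symmetric arcs, connected means strongly connected, so the graph is its own only
  component.\<close>

lemma num_components_connected:
  "Digraph_Component.connected G \<Longrightarrow> num_components G = 1"
  using symmetric_connected_imp_strongly_connected[OF sym_arcs] strongly_connected_eq_iff
  by (simp add: num_components_def)

lemma vertex_cut_setI:
  assumes "S \<subseteq> verts G" "2 \<le> num_components (delete_verts G S)"
  shows "vertex_cut_set G S"
proof -
  interpret H: graph "delete_verts G S" by (intro graph_induce_subgraph) auto
  have "\<not> Digraph_Component.connected (delete_verts G S)"
    using H.num_components_connected assms(2) by auto
  \<comment> \<open>The null graph has no component at all, whereas two are required.\<close>
  moreover have "S \<noteq> verts G"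
  proof
    assume "S = verts G"
    then have "H.sccs_verts = {}" using H.sccs_verts_conv_scc_of by simp
    then show False using assms(2) H.card_sccs_verts by (simp add: num_components_def)
  qed
  ultimately show ?thesis using assms(1) by (auto simp: vertex_cut_set_def)
qed

text \<open>\<open>Min\<close> is a lower bound only on a finite set; here finiteness comes from the
  cut-sets being subsets of the finite vertex set.\<close>

lemma toughness_le:
  assumes "vertex_cut_set G S"
  shows "toughness G \<le> real (card S) / real (num_components (delete_verts G S))"
proof -
  let ?r = "\<lambda>S. real (card S) / real (num_components (delete_verts G S))"
  have "{?r S | S. vertex_cut_set G S} \<subseteq> ?r ` Pow (verts G)"
    by (auto simp: vertex_cut_set_def)
  then have "finite {?r S | S. vertex_cut_set G S}"
    by (rule finite_subset) simp
  then show ?thesis unfolding toughness_def using assms by (intro Min_le) auto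
qed

lemma vertex_connectivity_le:
  assumes "vertex_cut_set G S"
  shows "vertex_connectivity G \<le> card S"
proof -
  let ?A = "{card S | S. vertex_cut_set G S \<or> S \<subseteq> verts G \<and> card (verts G - S) = 1}"
  have "?A \<subseteq> card ` Pow (verts G)"
    by (auto simp: vertex_cut_set_def)
  then have "finite ?A" by (rule finite_subset) simp
  then show ?thesis unfolding vertex_connectivity_def using assms by (intro Min_le) auto
qed

text \<open>Removing everything except two non-adjacent vertices leaves a disconnected graph, so
  there is a cut-set of size \<open>card (verts G) - 2\<close>.\<close>

lemma noncomplete_connectivity:
  assumes "\<not> complete_digraph (card (verts G)) G"
  shows "vertex_connectivity G + 2 \<le> card (verts G)"
proof -
  have "arcs_ends G \<noteq> {(u, v). (u, v) \<in> verts G \<times> verts G \<and> u \<noteq> v}"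
    using assms graph_axioms by (simp add: complete_digraph_def)
  moreover have "arcs_ends G \<subseteq> {(u, v). (u, v) \<in> verts G \<times> verts G \<and> u \<noteq> v}"
    using adj_in_verts adj_not_same by auto
  ultimately obtain u v where uv: "u \<in> verts G" "v \<in> verts G" "u \<noteq> v" "\<not> u \<rightarrow> v"
    by auto
  let ?S = "verts G - {u, v}"
  let ?H = "delete_verts G ?S"
  interpret H: graph ?H by (intro graph_induce_subgraph) auto
  have vH: "verts ?H = {u, v}" using uv by auto
  have "\<not> Digraph_Component.connected ?H"
  proof
    assume "Digraph_Component.connected ?H"
    then have "strongly_connected ?H"
      by (intro H.symmetric_connected_imp_strongly_connected H.sym_arcs)
    then have "u \<rightarrow>\<^sup>*\<^bsub>?H\<^esub> v"
      unfolding strongly_connected_def vH by blast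
    \<comment> \<open>The first arc of a path from \<open>u\<close> would have to lead to
      \<open>v\<close>, the only other vertex left.\<close>
    then show False
    proof (cases rule: H.converse_reachable_cases)
      case base
      then show False using uv by simp
    next
      case (step w)
      then have "w \<in> {u, v}" "u \<rightarrow> w" "u \<noteq> w"
        using H.adj_in_verts(2) vH dominates_induce_subgraphD H.adj_not_same by metis+
      then show False using uv by auto
    qed
  qed
  then have "vertex_cut_set G ?S" using uv by (auto simp: vertex_cut_set_def)
  then have "vertex_connectivity G \<le> card ?S" by (rule vertex_connectivity_le)
  moreover have "card (verts G) = card ?S + card {u, v}"
    using uv finite_verts card_mono[of "verts G" "{u, v}"] by (simp add: card_Diff_subset)
  moreover have "card {u, v} = 2" using uv by simp
  ultimately show ?thesis by linarith
qed

end

section \<open>From toughness and connectivity to factor-criticality\<close>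

theorem theorem3p1:
  fixes G :: "('a, 'b) pre_digraph" and n :: nat and \<epsilon> :: real
  assumes "n > 0"
    and "\<epsilon> > 0"
    and "Digraph.graph G"
    and "Digraph_Component.connected G"
    and "\<not> complete_digraph (card (verts G)) G"
    and "toughness G \<ge> 1 + \<epsilon>"
    and "card (verts G) mod 2 = n mod 2"
    and "real (vertex_connectivity G) > (real n - 2) * (1 + \<epsilon>) / \<epsilon>"
  shows "factor_critical n G"
proof -
  interpret graph G by fact
  have conn: "vertex_connectivity G + 2 \<le> card (verts G)"
    using assms(5) by (rule noncomplete_connectivity)
  have "n < card (verts G)"
  \<comment> \<open>For \<open>n = 1\<close> the connectivity bound is negative and says nothing,
    but a non-complete graph has at least two vertices. For larger \<open>n\<close> the factor
    \<open>(1 + \<epsilon>) / \<epsilon>\<close> exceeds 1, so the connectivity exceeds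
    \<open>n - 2\<close>.\<close>
  proof (cases "n = 1")
    case False
    then have "real n - 2 \<ge> 0" using \<open>n > 0\<close> by simp
    then have "real n - 2 \<le> (real n - 2) * (1 + \<epsilon>) / \<epsilon>"
      using \<open>\<epsilon> > 0\<close> by (simp add: field_simps)
    then have "real n < real (vertex_connectivity G + 2)" using assms(8) by simp
    then show ?thesis using conn by linarith
  qed (use conn in simp)
  moreover have parity: "even (card (verts G)) \<longleftrightarrow> even n"
    using assms(7) by (simp add: even_iff_mod_2_eq_zero)
  \<comment> \<open>Equal parity excludes order \<open>n + 1\<close>, which lifts the strict bound
    to \<open>n + 2\<close>.\<close>
  then have "card (verts G) \<noteq> n + 1" by auto
  ultimately have size: "n + 2 \<le> card (verts G)" by linarith
  have "\<exists>M. perfect_matching (delete_verts G S) M" if S: "S \<subseteq> verts G" "card S = n" for S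
  proof (rule ccontr)
    assume nopm: "\<nexists>M. perfect_matching (delete_verts G S) M"
    have finS: "finite S" using S finite_verts finite_subset by blast
    have "card (verts G) = card (verts G - S) + n"
      using S size finS by (simp add: card_Diff_subset)
    then have "even (card (verts (delete_verts G S)))"
      using parity unfolding induce_subgraph_verts by (metis even_add)
    moreover have "Digraph.graph (delete_verts G S)" by (intro graph_induce_subgraph) auto
    ultimately obtain T where "T \<subseteq> verts (delete_verts G S)"
      and "card T + 2 \<le> num_components (delete_verts (delete_verts G S) T)"
      using Tutte[OF _ _ nopm] by blast
    then have T: "T \<subseteq> verts G - S"
      and comps: "card T + 2 \<le> num_components (delete_verts G (S \<union> T))"
      unfolding delete_verts_delete_verts by simp_all
    have cut: "vertex_cut_set G (S \<union> T)"
      using S T comps by (intro vertex_cut_setI) auto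
    have "finite T" using T finite_verts by (meson finite_Diff finite_subset)
    then have cardST: "card (S \<union> T) = n + card T"
      using T S finS by (subst card_Un_disjoint) auto
    have "1 + \<epsilon> \<le> real (n + card T) / real (num_components (delete_verts G (S \<union> T)))"
      using toughness_le[OF cut] assms(6) unfolding cardST by linarith
    then have "(1 + \<epsilon>) * real (num_components (delete_verts G (S \<union> T))) \<le> real (n + card T)"
      using comps by (simp add: pos_le_divide_eq)
    moreover have "(1 + \<epsilon>) * real (card T + 2)
        \<le> (1 + \<epsilon>) * real (num_components (delete_verts G (S \<union> T)))"
      using comps \<open>\<epsilon> > 0\<close> by (intro mult_left_mono) linarith+
    \<comment> \<open>Cancelling \<open>card T + 2\<close> on both sides of the toughness bound
      leaves \<open>n - 2\<close> on the right.\<close>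
    ultimately have "\<epsilon> * (real (card T) + 2) \<le> real n - 2" by (simp add: algebra_simps)
    \<comment> \<open>Adding \<open>\<epsilon> * (n - 2)\<close> to both sides turns
      \<open>card T + 2\<close> into the size of the cut-set.\<close>
    then have "\<epsilon> * (real n + real (card T)) \<le> (real n - 2) * (1 + \<epsilon>)"
      by (simp add: algebra_simps)
    then have "real (n + card T) \<le> (real n - 2) * (1 + \<epsilon>) / \<epsilon>"
      using \<open>\<epsilon> > 0\<close> by (simp add: pos_le_divide_eq mult.commute)
    moreover have "vertex_connectivity G \<le> n + card T"
      using vertex_connectivity_le[OF cut] cardST by simp
    ultimately show False using assms(8) by linarith
  qed
  then show ?thesis using size assms(7) by (simp add: factor_critical_def)
qed

end
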